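(* Let $a$ and $b$ be positive integers such that $2\le a<b$ and $a$ does not divide $b$. Then the diagonal binary $\mathbb Z$-lattice $\ell=\langle a,b\rangle$ is not recoverable.
   Context: A $\mathbb Z$-lattice is a free $\mathbb Z$-module $L$ of finite rank with a positive definite symmetric bilinear form $B:L\times L\to\mathbb Z$ (integral valued). $\langle a_1,\dots,a_k\rangle$ denotes the $\mathbb Z$-lattice with an orthogonal basis $x_1,\dots,x_k$ satisfying $B(x_i,x_i)=a_i$. A $\mathbb Z$-lattice $\ell$ is represented by $L$ if there is a $\mathbb Z$-linear map $\sigma:\ell\to L$ with $B(\sigma x,\sigma y)=B(x,y)$ for all $x,y\in\ell$. A $\mathbb Z$-lattice $\ell$ is recoverable if there is a finite set $\{\ell_1,\dots,\ell_t\}$ of proper sublattices of $\ell$ such that every $\mathbb Z$-lattice (of any rank) that represents all of $\ell_1,\dots,\ell_t$ also represents $\ell$. *)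

theory Defs
  imports Complex_Main "HOL-Library.Poly_Mapping"
begin

text \<open>
  A lattice is a pair of a set \<open>L\<close> in some abelian group and a form \<open>B\<close>, of which only the values
  on \<open>L\<close> matter; a sublattice of \<open>L\<close> carries the restriction of the same \<open>B\<close>.
\<close>

text \<open>At most one of the two sums is nonempty: this is the usual integer multiple \<open>c x\<close>.\<close>

definition zscale :: "int \<Rightarrow> 'a::ab_group_add \<Rightarrow> 'a" where
  "zscale c x = (\<Sum>i<nat c. x) - (\<Sum>i<nat (- c). x)"

lemma zscale_of_nat_diff:
  "zscale (int m - int n) x = (\<Sum>i<m. x) - (\<Sum>i<n. x)"
proof -
  have split: "(\<Sum>i<k + l. x) = (\<Sum>i<k. x) + (\<Sum>i<l. x)" for k l :: nat
    by (induction l) (auto simp: algebra_simps)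
  show ?thesis
  proof (cases "n \<le> m")
    case True
    then obtain k where "m = k + n" by (metis add.commute le_Suc_ex)
    then show ?thesis by (simp add: zscale_def split)
  next
    case False
    then obtain k where "n = k + m" by (metis add.commute le_Suc_ex nat_le_linear)
    then show ?thesis by (simp add: zscale_def split)
  qed
qed

global_interpretation zmod: module "zscale :: int \<Rightarrow> 'a::ab_group_add \<Rightarrow> 'a"
proof
  fix a b :: int and x y :: 'a
  show "zscale a (x + y) = zscale a x + zscale a y"
    by (simp add: zscale_def sum.distrib)
  show add: "zscale (a + b) x = zscale a x + zscale b x" for a b and x :: 'a
  proof -
    obtain k l m n where ab: "a = int k - int l" "b = int m - int n"
      by (metis int_diff_cases)
    have split: "(\<Sum>i<k + l. x) = (\<Sum>i<k. x) + (\<Sum>i<l. x)" for k l :: nat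
      by (induction l) (auto simp: algebra_simps)
    have "a + b = int (k + m) - int (l + n)" using ab by simp
    then show ?thesis
      by (simp only: ab zscale_of_nat_diff split) simp
  qed
  show one: "zscale 1 x = x" for x :: 'a by (simp add: zscale_def)
  have zero: "zscale 0 x = 0" for x :: 'a by (simp add: zscale_def)
  show "zscale a (zscale b x) = zscale (a * b) x"
  proof (induction a rule: int_induct[of _ 0])
    case base
    then show ?case by (simp add: zero)
  next
    case (step1 i)
    then show ?case by (simp add: add one distrib_right)
  next
    case (step2 i)
    have "zscale (i - 1 + 1) (zscale b x) = zscale ((i - 1) * b + b) x"
      using step2 by (simp add: left_diff_distrib)
    then show ?case unfolding add one by simp
  qed
qed

text \<open>Rank \<open>0\<close> is allowed.\<close>

definition zlattice :: "'a::ab_group_add set \<Rightarrow> ('a \<Rightarrow> 'a \<Rightarrow> int) \<Rightarrow> bool" where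
  "zlattice L B \<longleftrightarrow>
     (\<exists>X. finite X \<and> zmod.independent X \<and> zmod.span X = L) \<and>
     (\<forall>x\<in>L. \<forall>y\<in>L. B x y = B y x) \<and>
     (\<forall>x\<in>L. \<forall>y\<in>L. \<forall>z\<in>L. B (x + y) z = B x z + B y z) \<and>
     (\<forall>c. \<forall>x\<in>L. \<forall>y\<in>L. B (zscale c x) y = c * B x y) \<and>
     (\<forall>x\<in>L. x \<noteq> 0 \<longrightarrow> B x x > 0)"

text \<open>\<open>represents M C L B\<close>: the lattice \<open>(L, B)\<close> is represented by the lattice \<open>(M, C)\<close>.\<close>

definition represents ::
    "'b::ab_group_add set \<Rightarrow> ('b \<Rightarrow> 'b \<Rightarrow> int) \<Rightarrow> 'a::ab_group_add set \<Rightarrow> ('a \<Rightarrow> 'a \<Rightarrow> int) \<Rightarrow> bool"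
  where
  "represents M C L B \<longleftrightarrow>
     (\<exists>\<sigma>. \<sigma> ` L \<subseteq> M \<and>
          (\<forall>x\<in>L. \<forall>y\<in>L. \<sigma> (x + y) = \<sigma> x + \<sigma> y) \<and>
          (\<forall>c. \<forall>x\<in>L. \<sigma> (zscale c x) = zscale c (\<sigma> x)) \<and>
          (\<forall>x\<in>L. \<forall>y\<in>L. C (\<sigma> x) (\<sigma> y) = B x y))"

definition proper_sublattice ::
    "'a::ab_group_add set \<Rightarrow> 'a set \<Rightarrow> ('a \<Rightarrow> 'a \<Rightarrow> int) \<Rightarrow> bool" where
  "proper_sublattice N L B \<longleftrightarrow> zlattice N B \<and> N \<subset> L"

text \<open>
  The quantifier over all lattices has to range over a fixed type. The free abelian group
  \<open>nat \<Rightarrow>\<^sub>0 int\<close> of countable rank contains an isometric copy of every lattice,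
  so nothing is lost; see \<open>zlattice_isometric_copy\<close> and \<open>recoverable_any_type\<close> below.
\<close>

definition recoverable :: "'a::ab_group_add set \<Rightarrow> ('a \<Rightarrow> 'a \<Rightarrow> int) \<Rightarrow> bool" where
  "recoverable L B \<longleftrightarrow>
     (\<exists>S. finite S \<and> (\<forall>N\<in>S. proper_sublattice N L B) \<and>
          (\<forall>(M :: (nat \<Rightarrow>\<^sub>0 int) set) C.
             zlattice M C \<and> (\<forall>N\<in>S. represents M C N B) \<longrightarrow> represents M C L B))"

text \<open>\<open>(L, B)\<close> is (a copy of) the lattice \<open>\<langle>a\<^sub>1, \<dots>, a\<^sub>k\<rangle>\<close>, where \<open>as = [a\<^sub>1, \<dots>, a\<^sub>k]\<close>.\<close>

definition diagonal_zlattice ::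
    "int list \<Rightarrow> 'a::ab_group_add set \<Rightarrow> ('a \<Rightarrow> 'a \<Rightarrow> int) \<Rightarrow> bool" where
  "diagonal_zlattice as L B \<longleftrightarrow>
     zlattice L B \<and>
     (\<exists>xs. length xs = length as \<and> distinct xs \<and>
           zmod.independent (set xs) \<and> zmod.span (set xs) = L \<and>
           (\<forall>i<length as. \<forall>j<length as. B (xs ! i) (xs ! j) = (if i = j then as ! i else 0)))"


text \<open>The remaining lemmas show that the choice of types above is harmless.\<close>

lemma represents_trans:
  assumes "represents M C L B" "represents K D M C"
  shows "represents K D L B"
proof -
  obtain s where s: "s ` L \<subseteq> M" "\<forall>x\<in>L. \<forall>y\<in>L. s (x + y) = s x + s y"
    "\<forall>c. \<forall>x\<in>L. s (zscale c x) = zscale c (s x)" "\<forall>x\<in>L. \<forall>y\<in>L. C (s x) (s y) = B x y"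
    using assms(1) unfolding represents_def by blast
  obtain t where t: "t ` M \<subseteq> K" "\<forall>x\<in>M. \<forall>y\<in>M. t (x + y) = t x + t y"
    "\<forall>c. \<forall>x\<in>M. t (zscale c x) = zscale c (t x)" "\<forall>x\<in>M. \<forall>y\<in>M. D (t x) (t y) = C x y"
    using assms(2) unfolding represents_def by blast
  have "s x \<in> M" if "x \<in> L" for x using s(1) that by blast
  then show ?thesis
    unfolding represents_def using s t by (intro exI[of _ "t \<circ> s"]) auto
qed

lemma lookup_zscale: "poly_mapping.lookup (zscale c p) i = c * poly_mapping.lookup p i"
  for p :: "'i \<Rightarrow>\<^sub>0 int"
  by (simp add: zscale_def lookup_minus lookup_sum left_diff_distrib[symmetric])

text \<open>The standard basis of \<open>nat \<Rightarrow>\<^sub>0 int\<close>, up to rank \<open>n\<close>.\<close>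

lemma frag_sum:
  fixes n :: nat and c :: "nat \<Rightarrow> int"
  shows "poly_mapping.lookup (\<Sum>i<n. zscale (c i) (frag_of i)) j = (if j < n then c j else 0)"
  by (simp add: lookup_sum lookup_zscale if_distrib[of "(*) _"] cong: if_cong)

lemma frag_expand:
  fixes n :: nat
  assumes "Poly_Mapping.keys p \<subseteq> {..<n}"
  shows "p = (\<Sum>i<n. zscale (poly_mapping.lookup p i) (frag_of i))"
proof (rule poly_mapping_eqI)
  fix j
  show "poly_mapping.lookup p j =
    poly_mapping.lookup (\<Sum>i<n. zscale (poly_mapping.lookup p i) (frag_of i)) j"
    unfolding frag_sum using assms by (auto simp: in_keys_iff)
qed

lemma inj_frag_of: "inj (frag_of :: nat \<Rightarrow> _)"
  by (auto simp: inj_on_def frag_of_eq)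

lemma frag_independent: "zmod.independent (frag_of ` {..<n::nat})"
proof -
  have "u v = 0" if "(\<Sum>v\<in>frag_of ` {..<n}. zscale (u v) v) = 0" and v: "v \<in> frag_of ` {..<n}" for u v
  proof -
    obtain j where j: "v = frag_of j" "j < n" using v by blast
    have "(\<Sum>i<n. zscale (u (frag_of i)) (frag_of i)) = 0"
      using that(1) by (simp add: sum.reindex inj_on_subset[OF inj_frag_of])
    then show ?thesis using frag_sum[of "\<lambda>i. u (frag_of i)" n j] j by simp
  qed
  then show ?thesis by (subst zmod.dependent_finite) auto
qed

lemma frag_span:
  "zmod.span (frag_of ` {..<n::nat}) = {p. Poly_Mapping.keys p \<subseteq> {..<n}}"
proof (rule zmod.span_unique)
  show "zmod.subspace {p :: nat \<Rightarrow>\<^sub>0 int. Poly_Mapping.keys p \<subseteq> {..<n}}"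
    by (rule zmod.subspaceI)
       (auto simp: in_keys_iff subset_iff lookup_add lookup_zscale, metis add.right_neutral)
next
  fix T :: "(nat \<Rightarrow>\<^sub>0 int) set"
  assume T: "frag_of ` {..<n} \<subseteq> T" "zmod.subspace T"
  show "{p. Poly_Mapping.keys p \<subseteq> {..<n}} \<subseteq> T"
  proof
    fix p :: "nat \<Rightarrow>\<^sub>0 int" assume "p \<in> {p. Poly_Mapping.keys p \<subseteq> {..<n}}"
    then have p: "p = (\<Sum>i<n. zscale (poly_mapping.lookup p i) (frag_of i))"
      using frag_expand by blast
    have "(\<Sum>i<n. zscale (poly_mapping.lookup p i) (frag_of i)) \<in> T"
      using T by (intro zmod.subspace_sum zmod.subspace_scale) auto
    then show "p \<in> T" using p by simp
  qed
qed auto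

theorem zlattice_isometric_copy:
  fixes L :: "'a::ab_group_add set"
  assumes "zlattice L B"
  shows "\<exists>(M :: (nat \<Rightarrow>\<^sub>0 int) set) C. zlattice M C \<and> represents M C L B \<and> represents L B M C"
proof -
  obtain X where X: "finite X" "zmod.independent X" "zmod.span X = L"
    using assms unfolding zlattice_def by blast
  obtain v where v: "bij_betw v {..<card X} X"
    using ex_bij_betw_nat_finite[OF X(1)] by (auto simp: atLeast0LessThan)
  define n where "n = card X"
  have v: "bij_betw v {..<n} X" using v by (simp add: n_def)
  define M :: "(nat \<Rightarrow>\<^sub>0 int) set" where "M = {p. Poly_Mapping.keys p \<subseteq> {..<n}}"
  define psi where "psi p = (\<Sum>i<n. zscale (poly_mapping.lookup p i) (v i))" for p
  define C where "C p q = B (psi p) (psi q)" for p q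
  have sym: "B x y = B y x" and add': "B (x + y) z = B x z + B y z"
      and scale': "B (zscale c x) y = c * B x y"
    if "x \<in> L" "y \<in> L" "z \<in> L" for c x y z
    using assms that unfolding zlattice_def by simp_all
  have pos: "B x x > 0" if "x \<in> L" "x \<noteq> 0" for x
    using assms that unfolding zlattice_def by simp
  have add: "psi (p + q) = psi p + psi q" for p q
    by (simp add: psi_def lookup_add zmod.scale_left_distrib sum.distrib)
  have scale: "psi (zscale c p) = zscale c (psi p)" for c p
    by (simp add: psi_def lookup_zscale zmod.scale_sum_right)
  have in_L: "psi p \<in> L" for p
    unfolding psi_def X(3)[symmetric] using v
    by (intro zmod.span_sum zmod.span_scale zmod.span_base) (auto simp: bij_betw_def)
  have zero: "p = 0" if "p \<in> M" "psi p = 0" for p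
  proof (rule poly_mapping_eqI)
    fix i
    show "poly_mapping.lookup p i = poly_mapping.lookup 0 i"
    proof (cases "i < n")
      case True
      define u where "u x = poly_mapping.lookup p (the_inv_into {..<n} v x)" for x
      have u: "u (v i) = poly_mapping.lookup p i" if "i < n" for i
        using that v by (simp add: u_def the_inv_into_f_f bij_betw_def)
      have "(\<Sum>x\<in>X. zscale (u x) x) = (\<Sum>i<n. zscale (u (v i)) (v i))"
        using v by (simp add: sum.reindex_bij_betw[symmetric, OF v])
      also have "\<dots> = psi p" by (simp add: psi_def u)
      finally have "(\<Sum>x\<in>X. zscale (u x) x) = 0" using that by simp
      then have "u (v i) = 0"
        using zmod.independentD[OF X(2) X(1) subset_refl] v True by (auto simp: bij_betw_def)
      then show ?thesis using u True by simp
    next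
      case False
      then show ?thesis using that(1) by (auto simp: M_def in_keys_iff subset_iff)
    qed
  qed
  have M_sub: "zmod.subspace M"
    unfolding M_def frag_span[symmetric] by simp
  have surj: "\<exists>p\<in>M. psi p = x" if x: "x \<in> L" for x
  proof -
    obtain u where u: "x = (\<Sum>y\<in>X. zscale (u y) y)"
      using x X(3) zmod.span_finite[OF X(1)] by auto
    define p where "p = (\<Sum>i<n. zscale (u (v i)) (frag_of i))"
    have l: "poly_mapping.lookup p j = (if j < n then u (v j) else 0)" for j
      unfolding p_def frag_sum ..
    have "psi p = x"
      using v by (simp add: psi_def l u sum.reindex_bij_betw[symmetric, OF v])
    moreover have "p \<in> M" by (auto simp: M_def in_keys_iff l split: if_splits)
    ultimately show ?thesis by blast
  qed
  have inj: "p = q" if "p \<in> M" "q \<in> M" "psi p = psi q" for p q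
  proof -
    have "psi (p - q) + psi q = psi p" by (simp add: add[symmetric])
    then have "psi (p - q) = 0" using that by simp
    moreover have "p - q \<in> M" using zmod.subspace_diff[OF M_sub] that by blast
    ultimately have "p - q = 0" using zero by blast
    then show ?thesis by simp
  qed
  have "zlattice M C"
  proof -
    have "finite (frag_of ` {..<n}) \<and> zmod.independent (frag_of ` {..<n}) \<and>
        zmod.span (frag_of ` {..<n}) = M"
      by (simp add: frag_independent frag_span M_def)
    moreover have "C p p > 0" if "p \<in> M" "p \<noteq> 0" for p
      using pos in_L zero that unfolding C_def by blast
    moreover have "C p q = C q p" "C (p + q) r = C p r + C q r" "C (zscale c p) q = c * C p q"
      for c p q r
      unfolding C_def add scale by (rule sym add' scale', (rule in_L)+)+
    ultimately show ?thesis
      unfolding zlattice_def by blast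
  qed
  moreover have "represents L B M C"
    unfolding represents_def using in_L add scale C_def by (intro exI[of _ psi]) auto
  moreover have "represents M C L B"
  proof -
    obtain s where s: "s x \<in> M" "psi (s x) = x" if "x \<in> L" for x
      using surj by metis
    have L_sub: "zmod.subspace L" using X(3) zmod.subspace_span by blast
    have "s (x + y) = s x + s y" if "x \<in> L" "y \<in> L" for x y
      using that s L_sub M_sub by (intro inj) (auto simp: add zmod.subspace_add)
    moreover have "s (zscale c x) = zscale c (s x)" if "x \<in> L" for c x
      using that s L_sub M_sub by (intro inj) (auto simp: scale zmod.subspace_scale)
    ultimately show ?thesis
      unfolding represents_def C_def using s by (intro exI[of _ s]) auto
  qed
  ultimately show ?thesis by blast
qed

theorem recoverable_any_type:
  fixes L :: "'a::ab_group_add set"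
  assumes "recoverable L B"
  shows "\<exists>S. finite S \<and> (\<forall>N\<in>S. proper_sublattice N L B) \<and>
          (\<forall>(M :: 'b::ab_group_add set) C.
             zlattice M C \<and> (\<forall>N\<in>S. represents M C N B) \<longrightarrow> represents M C L B)"
proof -
  obtain S where S: "finite S" "\<forall>N\<in>S. proper_sublattice N L B"
    "\<And>(M :: (nat \<Rightarrow>\<^sub>0 int) set) C.
       zlattice M C \<Longrightarrow> \<forall>N\<in>S. represents M C N B \<Longrightarrow> represents M C L B"
    using assms unfolding recoverable_def by blast
  have "represents M C L B" if M: "zlattice M C" "\<forall>N\<in>S. represents M C N B"
    for M :: "'b set" and C
  proof -
    obtain M' :: "(nat \<Rightarrow>\<^sub>0 int) set" and C' where
      M': "zlattice M' C'" "represents M' C' M C" "represents M C M' C'"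
      using zlattice_isometric_copy[OF M(1)] by blast
    then have "represents M' C' L B"
      using M(2) by (intro S(3)) (auto intro: represents_trans)
    then show ?thesis using M' represents_trans by blast
  qed
  then show ?thesis using S by blast
qed

theorem diagonal_zlattice_exists:
  assumes pos: "\<forall>a\<in>set as. a > 0"
  shows "\<exists>(L :: (nat \<Rightarrow>\<^sub>0 int) set) B. diagonal_zlattice as L B"
proof -
  define n where "n = length as"
  define L :: "(nat \<Rightarrow>\<^sub>0 int) set" where "L = {p. Poly_Mapping.keys p \<subseteq> {..<n}}"
  define B where "B p q =
    (\<Sum>i<n. as ! i * poly_mapping.lookup p i * poly_mapping.lookup q i)" for p q
  have basis: "finite (frag_of ` {..<n})" "zmod.independent (frag_of ` {..<n})"
      "zmod.span (frag_of ` {..<n}) = L"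
    by (simp_all add: frag_independent frag_span L_def)
  have "B p p > 0" if "p \<in> L" and p: "p \<noteq> 0" for p
  proof -
    obtain k where k: "k \<in> Poly_Mapping.keys p" using p by (metis keys_eq_empty ex_in_conv)
    have kn: "k < n" using k \<open>p \<in> L\<close> by (auto simp: L_def)
    have a: "as ! i > 0" if "i < n" for i using pos that by (simp add: n_def)
    show ?thesis unfolding B_def
    proof (rule sum_pos2[of _ k])
      show "0 < as ! k * poly_mapping.lookup p k * poly_mapping.lookup p k"
        using a[OF kn] k
        by (auto simp: in_keys_iff mult.assoc zero_less_mult_iff linorder_neq_iff)
      show "0 \<le> as ! i * poly_mapping.lookup p i * poly_mapping.lookup p i" if "i \<in> {..<n}" for i
        using a[of i] that by (simp add: mult.assoc)
    qed (use kn in auto)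
  qed
  moreover have "B p q = B q p" for p q
    by (simp add: B_def mult.assoc mult.left_commute mult.commute)
  moreover have "B (p + q) r = B p r + B q r" for p q r
    by (simp add: B_def lookup_add sum.distrib algebra_simps)
  moreover have "B (zscale c p) q = c * B p q" for c p q
    by (simp add: B_def lookup_zscale sum_distrib_left mult.assoc mult.left_commute)
  ultimately have "zlattice L B"
    unfolding zlattice_def using basis by blast
  moreover have "B (frag_of i) (frag_of j) = (if i = j then as ! i else 0)" if "i < n" for i j
    using that by (simp add: B_def if_distrib[of "(*) _"] cong: if_cong)
  moreover have "distinct (map (frag_of :: nat \<Rightarrow> _) [0..<n])"
    using inj_on_subset[OF inj_frag_of, of "{0..<n}"] by (simp add: distinct_map)
  moreover have "set (map (frag_of :: nat \<Rightarrow> _) [0..<n]) = frag_of ` {..<n}"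
    by (simp add: atLeast0LessThan)
  ultimately have "diagonal_zlattice as L B"
    unfolding diagonal_zlattice_def
    using basis(2,3) by (intro conjI exI[of _ "map frag_of [0..<n]"]) (simp_all add: n_def)
  then show ?thesis by blast
qed

end

theory Submission
  imports Defs "HOL-Library.Product_Plus"
begin

text \<open>
  Let \<open>x, y\<close> be the orthogonal basis of \<open>\<langle>a, b\<rangle>\<close>. In this lattice \<open>\<plusminus>x\<close> are the only vectors of
  norm \<open>a\<close>, and, as \<open>a\<close> does not divide \<open>b\<close>, \<open>\<plusminus>y\<close> are the only vectors of norm \<open>b\<close>. Let \<open>K\<close> be
  the binary lattice with Gram matrix \<open>(a, 1; 1, b)\<close>. A proper sublattice \<open>N\<close> contains at most one
  of \<open>x\<close> and \<open>y\<close>: if it contains \<open>x\<close>, then it lies in some \<open>\<langle>a, b c\<^sup>2\<rangle>\<close> with \<open>c \<ge> 2\<close> and is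
  represented by \<open>K \<bottom> \<langle>b c\<^sup>2\<rangle>\<close>; if it contains \<open>y\<close>, then similarly by \<open>K \<bottom> \<langle>a c\<^sup>2\<rangle>\<close>; otherwise
  trivially by \<open>K \<bottom> N\<close>. Summing the second summands over finitely many \<open>N\<close> gives \<open>K \<bottom> M\<close>, where
  every nonzero norm of \<open>M\<close> exceeds \<open>a\<close> and either exceeds \<open>b\<close> or is a multiple of \<open>a\<close>. Then the
  vectors of norm \<open>a\<close> of \<open>K \<bottom> M\<close> are \<open>\<plusminus>\<close> the first basis vector of \<open>K\<close>, and no vector of norm \<open>b\<close>
  is orthogonal to it.
\<close>

section \<open>Orthogonal sums\<close>

lemma zlatticeD:
  assumes "zlattice L B"
  shows zlattice_subspace: "zmod.subspace L"
    and zlattice_sym: "\<And>x y. x \<in> L \<Longrightarrow> y \<in> L \<Longrightarrow> B x y = B y x"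
    and zlattice_add: "\<And>x y z. x \<in> L \<Longrightarrow> y \<in> L \<Longrightarrow> z \<in> L \<Longrightarrow> B (x + y) z = B x z + B y z"
    and zlattice_scale: "\<And>c x y. x \<in> L \<Longrightarrow> y \<in> L \<Longrightarrow> B (zscale c x) y = c * B x y"
    and zlattice_pos: "\<And>x. x \<in> L \<Longrightarrow> x \<noteq> 0 \<Longrightarrow> 0 < B x x"
  using assms unfolding zlattice_def by (auto intro: zmod.subspace_span)

lemma zlattice_zero_left:
  assumes "zlattice L B" "y \<in> L"
  shows "B 0 y = 0"
proof -
  have "0 \<in> L" using zlattice_subspace[OF assms(1)] by (rule zmod.subspace_0)
  then have "B (zscale 0 0) y = 0" using zlattice_scale[OF assms(1), of 0 y 0] assms(2) by simp
  then show ?thesis by simp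
qed

lemma zlattice_norm_nonneg: "zlattice L B \<Longrightarrow> x \<in> L \<Longrightarrow> 0 \<le> B x x"
  by (cases "x = 0") (auto simp: zlattice_zero_left dest: zlattice_pos)

section \<open>Free modules of finite rank and their products\<close>

lemma zscale_Pair: "zscale c (x, y) = (zscale c x, zscale c y)"
  by (simp add: zscale_def prod_eq_iff fst_sum snd_sum)

lemma zscale_int: "zscale c x = c * x" for x :: int
  by (simp add: zscale_def left_diff_distrib[symmetric])

text \<open>The clause of \<open>zlattice\<close> that does not mention the form, split off so that
  it can be treated once for products.\<close>

definition finite_free :: "'a::ab_group_add set \<Rightarrow> bool" where
  "finite_free L \<longleftrightarrow> (\<exists>X. finite X \<and> zmod.independent X \<and> zmod.span X = L)"

lemma finite_free_int: "finite_free (UNIV :: int set)"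
proof -
  have "zmod.independent {1 :: int}"
    by (subst zmod.dependent_finite) (auto simp: zscale_int)
  moreover have "zmod.span {1 :: int} = UNIV"
    by (auto simp: zmod.span_singleton zscale_int)
  ultimately show ?thesis unfolding finite_free_def by blast
qed

lemma finite_free_Times:
  assumes "finite_free L" "finite_free M"
  shows "finite_free (L \<times> M)"
proof -
  obtain X where X: "finite X" "zmod.independent X" "zmod.span X = L"
    using assms(1) unfolding finite_free_def by blast
  obtain Y where Y: "finite Y" "zmod.independent Y" "zmod.span Y = M"
    using assms(2) unfolding finite_free_def by blast
  define Z where "Z = (\<lambda>x. (x, 0)) ` X \<union> (\<lambda>y. (0, y)) ` Y"
  \<comment> \<open>The two axes meet only in the origin, which independence keeps out of the
    basis.\<close>
  have "0 \<notin> X" using X(2) zmod.dependent_zero by blast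
  then have disj: "(\<lambda>x. (x, 0)) ` X \<inter> (\<lambda>y. (0, y)) ` Y = {}" by auto
  have fin: "finite Z" using X(1) Y(1) by (simp add: Z_def)
  have sumZ: "(\<Sum>z\<in>Z. zscale (u z) z) =
      (\<Sum>x\<in>X. zscale (u (x, 0)) x, \<Sum>y\<in>Y. zscale (u (0, y)) y)" for u
    unfolding Z_def using X(1) Y(1) disj
    by (subst sum.union_disjoint)
       (auto simp: sum.reindex inj_on_def zscale_Pair prod_eq_iff fst_sum snd_sum)
  have "zmod.independent Z"
  proof (subst zmod.dependent_finite[OF fin], clarify)
    fix u z
    assume "(\<Sum>z\<in>Z. zscale (u z) z) = 0" and z: "z \<in> Z" "u z \<noteq> 0"
    then have "(\<Sum>x\<in>X. zscale (u (x, 0)) x) = 0" "(\<Sum>y\<in>Y. zscale (u (0, y)) y) = 0"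
      unfolding sumZ by (simp_all add: prod_eq_iff)
    then have "\<forall>x\<in>X. u (x, 0) = 0" "\<forall>y\<in>Y. u (0, y) = 0"
      using zmod.independentD[OF X(2) X(1) subset_refl, of "\<lambda>x. u (x, 0)"]
        zmod.independentD[OF Y(2) Y(1) subset_refl, of "\<lambda>y. u (0, y)"] by auto
    then show False using z by (auto simp: Z_def)
  qed
  moreover have "zmod.span Z = L \<times> M"
  proof
    have "(\<Sum>x\<in>X. zscale (u x) x) \<in> L" "(\<Sum>y\<in>Y. zscale (v y) y) \<in> M" for u v
      unfolding X(3)[symmetric] Y(3)[symmetric]
      by (rule zmod.span_sum, rule zmod.span_scale, erule zmod.span_base)+
    then show "zmod.span Z \<subseteq> L \<times> M"
      unfolding zmod.span_finite[OF fin] sumZ by auto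
    show "L \<times> M \<subseteq> zmod.span Z"
    proof
      fix p assume "p \<in> L \<times> M"
      then obtain u v where uv: "p = (\<Sum>x\<in>X. zscale (u x) x, \<Sum>y\<in>Y. zscale (v y) y)"
        unfolding X(3)[symmetric] Y(3)[symmetric] zmod.span_finite[OF X(1)]
          zmod.span_finite[OF Y(1)] by auto
      have "p = (\<Sum>x\<in>X. zscale (u x) (x, 0)) + (\<Sum>y\<in>Y. zscale (v y) (0, y))"
        by (simp add: uv zscale_Pair prod_eq_iff fst_sum snd_sum)
      also have "\<dots> \<in> zmod.span Z"
        by (intro zmod.span_add zmod.span_sum zmod.span_scale zmod.span_base) (auto simp: Z_def)
      finally show "p \<in> zmod.span Z" .
    qed
  qed
  ultimately show ?thesis unfolding finite_free_def using fin by blast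
qed

section \<open>Forms and representations on orthogonal sums\<close>

definition orth_sum ::
    "('a \<Rightarrow> 'a \<Rightarrow> int) \<Rightarrow> ('b \<Rightarrow> 'b \<Rightarrow> int) \<Rightarrow> 'a \<times> 'b \<Rightarrow> 'a \<times> 'b \<Rightarrow> int" where
  "orth_sum B C p q = B (fst p) (fst q) + C (snd p) (snd q)"

lemma zlattice_orth_sum:
  assumes L: "zlattice L B" and M: "zlattice M C"
  shows "zlattice (L \<times> M) (orth_sum B C)"
proof -
  have free: "finite_free (L \<times> M)"
    using L M unfolding zlattice_def finite_free_def[symmetric] by (intro finite_free_Times) auto
  have pos: "orth_sum B C p p > 0" if "p \<in> L \<times> M" "p \<noteq> 0" for p
  proof (cases "fst p = 0")
    case True
    then have "C (snd p) (snd p) > 0" using that zlattice_pos[OF M] by (auto simp: prod_eq_iff)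
    then show ?thesis using that zlattice_norm_nonneg[OF L] by (auto simp: orth_sum_def intro: add_nonneg_pos)
  next
    case False
    then have "B (fst p) (fst p) > 0" using that zlattice_pos[OF L] by auto
    then show ?thesis using that zlattice_norm_nonneg[OF M] by (auto simp: orth_sum_def intro: add_pos_nonneg)
  qed
  have sym: "orth_sum B C p q = orth_sum B C q p" if "p \<in> L \<times> M" "q \<in> L \<times> M" for p q
    using that zlattice_sym[OF L] zlattice_sym[OF M] by (auto simp: orth_sum_def)
  have add: "orth_sum B C (p + q) r = orth_sum B C p r + orth_sum B C q r"
    if "p \<in> L \<times> M" "q \<in> L \<times> M" "r \<in> L \<times> M" for p q r
    using that zlattice_add[OF L] zlattice_add[OF M] by (auto simp: orth_sum_def)
  have scale: "orth_sum B C (zscale c p) q = c * orth_sum B C p q"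
    if "p \<in> L \<times> M" "q \<in> L \<times> M" for c p q
    using that zlattice_scale[OF L] zlattice_scale[OF M]
    by (auto simp: orth_sum_def zscale_Pair distrib_left)
  show ?thesis
    unfolding zlattice_def finite_free_def[symmetric]
    by (intro conjI ballI allI impI free pos sym add scale)
qed

lemma represents_orth_sum_left:
  assumes "zlattice M C"
  shows "represents (L \<times> M) (orth_sum B C) L B"
  unfolding represents_def
  using zmod.subspace_0[OF zlattice_subspace[OF assms]]
  by (intro exI[of _ "\<lambda>x. (x, 0)"]) (auto simp: zscale_Pair orth_sum_def zlattice_zero_left[OF assms])

lemma represents_orth_sum_right:
  assumes "zlattice L B"
  shows "represents (L \<times> M) (orth_sum B C) M C"
  unfolding represents_def
  using zmod.subspace_0[OF zlattice_subspace[OF assms]]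
  by (intro exI[of _ "\<lambda>x. (0, x)"]) (auto simp: zscale_Pair orth_sum_def zlattice_zero_left[OF assms])

lemma represents_orth_sum_mono:
  assumes "represents M' C' M C"
  shows "represents (L \<times> M') (orth_sum B C') (L \<times> M) (orth_sum B C)"
proof -
  obtain s where "s ` M \<subseteq> M'" "\<forall>x\<in>M. \<forall>y\<in>M. s (x + y) = s x + s y"
    "\<forall>c. \<forall>x\<in>M. s (zscale c x) = zscale c (s x)" "\<forall>x\<in>M. \<forall>y\<in>M. C' (s x) (s y) = C x y"
    using assms unfolding represents_def by blast
  then show ?thesis unfolding represents_def
    by (intro exI[of _ "map_prod id s"]) (auto simp: zscale_Pair orth_sum_def)
qed

lemma zlattice_rank_one:
  assumes "k > 0"
  shows "zlattice (UNIV :: int set) (\<lambda>s t. k * s * t)"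
  unfolding zlattice_def finite_free_def[symmetric]
  using finite_free_int assms
  by (auto simp: zscale_int distrib_left distrib_right mult.assoc zero_less_mult_iff)

section \<open>The complementary summand\<close>

text \<open>Norms allowed in the complement: \<open>a < q\<close> leaves no room for a nonzero
  component of a vector of norm \<open>a\<close>, and the disjunction rules out \<open>q = b\<close>
  when \<open>a\<close> does not divide \<open>b\<close>. Asking only for \<open>a < q\<close> and
  \<open>q \<noteq> b\<close> would not survive orthogonal sums.\<close>

definition admissible :: "int \<Rightarrow> int \<Rightarrow> int \<Rightarrow> bool" where
  "admissible a b q \<longleftrightarrow> q = 0 \<or> a < q \<and> (b < q \<or> a dvd q)"

definition admissible_lattice ::
    "int \<Rightarrow> int \<Rightarrow> 'a::ab_group_add set \<Rightarrow> ('a \<Rightarrow> 'a \<Rightarrow> int) \<Rightarrow> bool" where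
  "admissible_lattice a b M C \<longleftrightarrow> zlattice M C \<and> (\<forall>w\<in>M. admissible a b (C w w))"

text \<open>If one nonzero summand exceeds \<open>b\<close>, so does the sum; otherwise both are
  multiples of \<open>a\<close>.\<close>

lemma admissible_add:
  assumes "0 < a" "0 < b" "admissible a b p" "admissible a b q"
  shows "admissible a b (p + q)"
  using assms unfolding admissible_def by auto

text \<open>The copy is itself represented by \<open>M\<close>, so its norms are norms of
  \<open>M\<close>. This brings product types back to one fixed type.\<close>

lemma admissible_lattice_copy:
  assumes "admissible_lattice a b M C"
  shows "\<exists>(M' :: (nat \<Rightarrow>\<^sub>0 int) set) C'. admissible_lattice a b M' C' \<and> represents M' C' M C"
proof -
  obtain M' :: "(nat \<Rightarrow>\<^sub>0 int) set" and C' where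
    M': "zlattice M' C'" "represents M' C' M C" "represents M C M' C'"
    using zlattice_isometric_copy assms unfolding admissible_lattice_def by blast
  from M'(3) obtain s where "s ` M' \<subseteq> M" "\<forall>x\<in>M'. \<forall>y\<in>M'. C (s x) (s y) = C' x y"
    unfolding represents_def by blast
  then have "\<forall>w\<in>M'. admissible a b (C' w w)"
    using assms unfolding admissible_lattice_def by (metis image_subset_iff)
  then show ?thesis using M' unfolding admissible_lattice_def by blast
qed

lemma glued_copy:
  assumes "admissible_lattice a b M C" "represents (K \<times> M) (orth_sum D C) L B"
  shows "\<exists>(M' :: (nat \<Rightarrow>\<^sub>0 int) set) C'. admissible_lattice a b M' C' \<and>
    represents (K \<times> M') (orth_sum D C') L B"
  using admissible_lattice_copy[OF assms(1)] represents_trans[OF assms(2)]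
    represents_orth_sum_mono by blast

lemma admissible_lattice_orth_sum:
  assumes "0 < a" "0 < b" "admissible_lattice a b L B" "admissible_lattice a b M C"
  shows "admissible_lattice a b (L \<times> M) (orth_sum B C)"
  using assms zlattice_orth_sum[of L B M C]
  by (auto simp: admissible_lattice_def orth_sum_def intro: admissible_add)

text \<open>Induction starting from the zero lattice: each step takes the orthogonal sum with the
  next member and copies it back into \<open>nat \<Rightarrow>\<^sub>0 int\<close>, since the
  product changes the type.\<close>

lemma common_admissible_lattice:
  fixes F :: "'i \<Rightarrow> (nat \<Rightarrow>\<^sub>0 int) set"
  assumes "finite I" "0 < a" "0 < b" "\<forall>i\<in>I. admissible_lattice a b (F i) (G i)"
  shows "\<exists>(M :: (nat \<Rightarrow>\<^sub>0 int) set) C. admissible_lattice a b M C \<and>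
    (\<forall>i\<in>I. represents M C (F i) (G i))"
  using assms(1,4)
proof (induction I)
  case empty
  have "zlattice (zmod.span {} :: (nat \<Rightarrow>\<^sub>0 int) set) (\<lambda>_ _. 0)"
    unfolding zlattice_def by (auto intro!: exI[of _ "{}"] simp: zmod.independent_empty)
  then show ?case by (auto simp: admissible_lattice_def admissible_def)
next
  case (insert j I)
  then obtain M :: "(nat \<Rightarrow>\<^sub>0 int) set" and C where
    M: "admissible_lattice a b M C" "\<forall>i\<in>I. represents M C (F i) (G i)" by auto
  have j: "admissible_lattice a b (F j) (G j)" using insert.prems by simp
  obtain M' :: "(nat \<Rightarrow>\<^sub>0 int) set" and C' where
    M': "admissible_lattice a b M' C'" "represents M' C' (F j \<times> M) (orth_sum (G j) C)"
    using admissible_lattice_copy[OF admissible_lattice_orth_sum[OF assms(2,3) j M(1)]] by blast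
  have "represents (F j \<times> M) (orth_sum (G j) C) (F i) (G i)" if "i \<in> insert j I" for i
    using that M(2) j M(1) represents_orth_sum_left represents_orth_sum_right represents_trans
    unfolding admissible_lattice_def by (metis insertE)
  then have "\<forall>i\<in>insert j I. represents M' C' (F i) (G i)"
    using represents_trans[OF _ M'(2)] by blast
  then show ?case using M'(1) by blast
qed

section \<open>The binary summand\<close>

text \<open>Gram matrix (a, 1; 1, b) in the standard basis: the axes carry the norms
  \<open>a\<close> and \<open>b\<close>, and the entry 1 keeps them from being orthogonal.\<close>

definition glue_form :: "int \<Rightarrow> int \<Rightarrow> int \<times> int \<Rightarrow> int \<times> int \<Rightarrow> int" where
  "glue_form a b p q =
    a * fst p * fst q + fst p * snd q + snd p * fst q + b * snd p * snd q"

text \<open>Completing the square; the factor \<open>a\<close> avoids division, and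
  \<open>a * b - 1\<close> is the determinant.\<close>

lemma glue_form_norm:
  "a * glue_form a b (m, n) (m, n) = (a * m + n)\<^sup>2 + (a * b - 1) * n\<^sup>2"
  by (simp add: glue_form_def power2_eq_square algebra_simps)

lemma int_square_ge_1: "n \<noteq> 0 \<Longrightarrow> 1 \<le> n\<^sup>2" for n :: int
  by (metis int_one_le_iff_zero_less zero_less_power2)

text \<open>By the completed square, \<open>a\<close> times the norm is at least
  \<open>a * b - 1\<close>, which exceeds \<open>a * a\<close> because \<open>b \<ge> a + 1\<close>
  and \<open>a \<ge> 2\<close>. So vectors of norm at most \<open>a\<close> lie on the first
  axis.\<close>

lemma glue_form_norm_gt:
  assumes "2 \<le> a" "a < b" "n \<noteq> 0"
  shows "a < glue_form a b (m, n) (m, n)"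
proof -
  have "a * (a + 1) \<le> a * b" using assms by (intro mult_left_mono) auto
  then have ab: "a * a < a * b - 1" using assms by (simp add: distrib_left)
  moreover have "0 < a * a" using assms by simp
  ultimately have "(a * b - 1) * 1 \<le> (a * b - 1) * n\<^sup>2"
    using int_square_ge_1[OF assms(3)] by (intro mult_left_mono) auto
  then have "a * a < (a * b - 1) * n\<^sup>2" using ab by simp
  then have "a * a < a * glue_form a b (m, n) (m, n)"
    unfolding glue_form_norm by (intro add_strict_increasing2) auto
  then show ?thesis using assms by simp
qed

lemma zlattice_glue_form:
  assumes "2 \<le> a" "a < b"
  shows "zlattice UNIV (glue_form a b)"
proof -
  have "finite_free (UNIV :: (int \<times> int) set)"
    using finite_free_Times[OF finite_free_int finite_free_int] by simp
  moreover have "glue_form a b p p > 0" if "p \<noteq> 0" for p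
  proof (cases p)
    case (Pair m n)
    show ?thesis
    proof (cases "n = 0")
      case True
      then have "m \<noteq> 0" using that Pair by (auto simp: zero_prod_def)
      then have "0 < a * m\<^sup>2" using assms by simp
      then show ?thesis using True Pair by (simp add: glue_form_def power2_eq_square mult.assoc)
    next
      case False
      then show ?thesis using glue_form_norm_gt[OF assms] Pair assms by (smt (verit))
    qed
  qed
  ultimately show ?thesis
    unfolding zlattice_def finite_free_def[symmetric]
    by (auto simp: glue_form_def zscale_Pair zscale_int algebra_simps)
qed

lemma not_represents_glued:
  assumes ab: "2 \<le> a" "a < b" "\<not> a dvd b"
    and M: "admissible_lattice a b M C"
    and xy: "x \<in> L" "y \<in> L" "B x x = a" "B y y = b" "B x y = 0"
  shows "\<not> represents (UNIV \<times> M) (orth_sum (glue_form a b) C) L B"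
proof
  assume "represents (UNIV \<times> M) (orth_sum (glue_form a b) C) L B"
  then obtain s where s: "s ` L \<subseteq> UNIV \<times> M"
    "\<forall>x\<in>L. \<forall>y\<in>L. orth_sum (glue_form a b) C (s x) (s y) = B x y"
    unfolding represents_def by blast
  obtain m n w where u: "s x = ((m, n), w)" by (metis prod.collapse)
  obtain m' n' w' where v: "s y = ((m', n'), w')" by (metis prod.collapse)
  have w: "w \<in> M" "w' \<in> M" using s(1) xy(1,2) u v by (force)+
  have Z: "zlattice M C" and adm: "admissible a b (C w w)" "admissible a b (C w' w')"
    using M w unfolding admissible_lattice_def by auto
  have nn: "0 \<le> C w w" "0 \<le> C w' w'" using zlattice_norm_nonneg[OF Z] w by auto
  have xx: "glue_form a b (m, n) (m, n) + C w w = a"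
    and xy0: "glue_form a b (m, n) (m', n') + C w w' = 0"
    and yy: "glue_form a b (m', n') (m', n') + C w' w' = b"
    using s(2) xy u v by (force simp: orth_sum_def)+
  have n0: "n = 0" using glue_form_norm_gt[OF ab(1,2), of n m] xx nn by linarith
  then have am: "a * m\<^sup>2 + C w w = a"
    using xx by (simp add: glue_form_def power2_eq_square mult.assoc)
  moreover have "0 \<le> a * m\<^sup>2" using ab by simp
  \<comment> \<open>The norm of \<open>w\<close> is at most \<open>a\<close>, and 0 is the only
    admissible value in that range.\<close>
  ultimately have Cw: "C w w = 0" using adm(1) unfolding admissible_def by linarith
  then have "w = 0" using zlattice_pos[OF Z w(1)] by fastforce
  then have Cww': "C w w' = 0" using zlattice_zero_left[OF Z w(2)] by simp
  have "m \<noteq> 0" using am Cw ab by auto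
  moreover have "m * (a * m' + n') = 0"
    using xy0 Cww' n0 by (simp add: glue_form_def algebra_simps)
  \<comment> \<open>Orthogonality to a nonzero multiple of the first basis vector fixes the
    direction of the \<open>K\<close>-component of the image of \<open>y\<close>.\<close>
  ultimately have n': "n' = - (a * m')" by simp
  have gy: "glue_form a b (m', n') (m', n') = (a * (a * b - 1)) * m'\<^sup>2"
    by (simp add: n' glue_form_def power2_eq_square algebra_simps)
  have "m' = 0"
  proof (rule ccontr)
    assume "m' \<noteq> 0"
    \<comment> \<open>A nonzero vector in this direction is too long: its norm is at least
      \<open>a * (a * b - 1)\<close>, which exceeds \<open>b\<close>.\<close>
    have "2 * b \<le> a * b" using ab by (intro mult_right_mono) auto
    then have big: "b < a * b - 1" using ab by linarith
    have "1 * (a * b - 1) \<le> a * (a * b - 1)" using big ab by (intro mult_right_mono) auto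
    with big have big': "b < a * (a * b - 1)" by (metis less_le_trans mult_1)
    then have "a * (a * b - 1) * 1 \<le> a * (a * b - 1) * m'\<^sup>2"
      using int_square_ge_1[OF \<open>m' \<noteq> 0\<close>] ab by (intro mult_left_mono) auto
    then show False using big' yy gy nn by linarith
  qed
  \<comment> \<open>The whole norm \<open>b\<close> would have to come from \<open>M\<close>, where
    it is not admissible.\<close>
  then have "C w' w' = b" using yy gy by simp
  then show False using adm(2) ab unfolding admissible_def by auto
qed

section \<open>Proper sublattices of a diagonal binary lattice\<close>

text \<open>Subgroups of the integers are principal: division with remainder shows that the least
  positive element generates, and it is not 1. For the zero subgroup any \<open>c\<close>
  works.\<close>

lemma int_proper_subspace:
  assumes I: "zmod.subspace (I :: int set)" and "1 \<notin> I"
  shows "\<exists>c\<ge>2. \<forall>n\<in>I. c dvd n"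
proof (cases "I \<subseteq> {0}")
  case True
  then show ?thesis by (intro exI[of _ 2]) auto
next
  case False
  have mult: "k * n \<in> I" if "n \<in> I" for k n
    using zmod.subspace_scale[OF I that] by (simp add: zscale_int)
  obtain n where n: "n \<in> I" "n \<noteq> 0" using False by blast
  have "\<bar>n\<bar> \<in> I"
    using mult[OF n(1), of "sgn n"] by (simp add: abs_sgn mult.commute)
  then have "\<exists>k::nat. 0 < k \<and> int k \<in> I"
    using n(2) by (intro exI[of _ "nat \<bar>n\<bar>"]) simp
  then obtain k where k: "0 < k" "int k \<in> I" "\<And>j. 0 < j \<Longrightarrow> int j \<in> I \<Longrightarrow> k \<le> j"
    using exists_least_iff[of "\<lambda>k. 0 < k \<and> int k \<in> I"] by (meson not_le)
  have "k \<noteq> 1" using k(2) \<open>1 \<notin> I\<close> by auto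
  moreover have "int k dvd n" if "n \<in> I" for n
  proof -
    have "n - (n div int k) * int k \<in> I"
      using that mult[OF k(2)] by (intro zmod.subspace_diff[OF I]) auto
    then have "n mod int k \<in> I" by (simp add: minus_div_mult_eq_mod)
    moreover have r: "0 \<le> n mod int k" "n mod int k < int k" using k(1) by simp_all
    ultimately have "n mod int k = 0"
      using k(3)[of "nat (n mod int k)"] by (cases "n mod int k = 0") auto
    then show ?thesis by (simp add: dvd_eq_mod_eq_0)
  qed
  ultimately show ?thesis using k(1) by (intro exI[of _ "int k"]) auto
qed

text \<open>The integers \<open>n\<close> with \<open>zscale n z\<close> in \<open>N\<close> form a
  subgroup that misses 1.\<close>

lemma multiples_in_subspace:
  assumes N: "zmod.subspace N" and "z \<notin> N"
  shows "\<exists>c\<ge>2. \<forall>n. zscale n z \<in> N \<longrightarrow> c dvd n"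
proof -
  have "zmod.subspace {n. zscale n z \<in> N}"
    by (rule zmod.subspaceI)
       (auto simp: zmod.subspace_0[OF N] zmod.scale_left_distrib zscale_int
          zmod.scale_scale[symmetric] simp del: zmod.scale_scale
          intro: zmod.subspace_add[OF N] zmod.subspace_scale[OF N])
  then show ?thesis using int_proper_subspace[of "{n. zscale n z \<in> N}"] assms(2) by simp
qed

lemma square_ge_4: "2 \<le> \<bar>c\<bar> \<Longrightarrow> 4 \<le> c\<^sup>2" for c :: int
  using power_mono[of 2 "\<bar>c\<bar>" 2] by simp

lemma multiple_square_gt:
  fixes k c :: int
  assumes "0 < k" "2 \<le> \<bar>c\<bar>"
  shows "k < k * c\<^sup>2"
  using mult_left_mono[OF square_ge_4[OF assms(2)], of k] assms(1) by linarith

section \<open>Coordinates in a binary diagonal lattice\<close>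

locale binary_diagonal =
  fixes a b :: int and L :: "'a::ab_group_add set" and B :: "'a \<Rightarrow> 'a \<Rightarrow> int" and x y :: 'a
  assumes ab: "2 \<le> a" "a < b"
    and L: "zlattice L B"
    and span: "zmod.span {x, y} = L"
    and gram: "B x x = a" "B y y = b" "B x y = 0"
begin

lemma basis_in: "x \<in> L" "y \<in> L"
  unfolding span[symmetric] by (auto intro: zmod.span_base)

lemma scale_in: "w \<in> L \<Longrightarrow> zscale c w \<in> L"
  using zlattice_subspace[OF L] zmod.subspace_scale by blast

text \<open>Pairing with a basis vector gives its norm times the coordinate, so the division is
  exact on \<open>L\<close> and uniqueness of coordinates becomes a computation.\<close>

definition cx :: "'a \<Rightarrow> int" where "cx w = B w x div a"
definition cy :: "'a \<Rightarrow> int" where "cy w = B w y div b"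

lemma coordinates_unique:
  "cx (zscale m x + zscale n y) = m" "cy (zscale m x + zscale n y) = n"
  using ab gram basis_in zlattice_sym[OF L, of x y]
  by (simp_all add: cx_def cy_def zlattice_add[OF L] zlattice_scale[OF L] scale_in)

lemma expand:
  assumes "w \<in> L"
  shows "w = zscale (cx w) x + zscale (cy w) y"
proof -
  obtain m where "w - zscale m x \<in> zmod.span {y}"
    using assms unfolding span[symmetric] zmod.span_breakdown_eq[of w x] by blast
  then obtain n where "w - zscale m x = zscale n y"
    by (auto simp: zmod.span_singleton)
  then have "w = zscale m x + zscale n y" by (simp add: algebra_simps)
  then show ?thesis using coordinates_unique[of m n] by simp
qed

lemma coordinates_add:
  assumes "v \<in> L" "w \<in> L"
  shows "cx (v + w) = cx v + cx w" "cy (v + w) = cy v + cy w"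
proof -
  have "v + w = zscale (cx v + cx w) x + zscale (cy v + cy w) y"
    using expand[OF assms(1)] expand[OF assms(2)]
    by (simp add: zmod.scale_left_distrib algebra_simps)
  then show "cx (v + w) = cx v + cx w" "cy (v + w) = cy v + cy w"
    using coordinates_unique by simp_all
qed

lemma coordinates_scale:
  assumes "w \<in> L"
  shows "cx (zscale c w) = c * cx w" "cy (zscale c w) = c * cy w"
proof -
  have "zscale c w = zscale (c * cx w) x + zscale (c * cy w) y"
    by (subst expand[OF assms]) (simp add: zmod.scale_right_distrib)
  then show "cx (zscale c w) = c * cx w" "cy (zscale c w) = c * cy w"
    using coordinates_unique by simp_all
qed

lemma form_coordinates:
  assumes "v \<in> L" "w \<in> L"
  shows "B v w = a * cx v * cx w + b * cy v * cy w"
proof -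
  have *: "B v z = cx v * B x z + cy v * B y z" if "z \<in> L" for z
    by (subst expand[OF assms(1)])
       (simp add: zlattice_add[OF L] zlattice_scale[OF L] scale_in basis_in that)
  \<comment> \<open>\<open>zlattice\<close> states linearity in the first argument; symmetry carries
    it over to the second.\<close>
  have **: "B z w = cx w * B z x + cy w * B z y" if "z \<in> L" for z
    using expand[OF assms(2)] that basis_in
    by (metis zlattice_sym[OF L] assms(2) zlattice_add[OF L] zlattice_scale[OF L] scale_in)
  show ?thesis
    using *[OF assms(2)] **[of x] **[of y] basis_in gram zlattice_sym[OF L, of x y]
    by (simp add: algebra_simps)
qed

text \<open>Properness of \<open>N\<close> enters here: with both basis vectors \<open>N\<close>
  would be all of \<open>L\<close>.\<close>

lemma proper_not_both:
  assumes N: "zlattice N B" "N \<subset> L" and "x \<in> N" "y \<in> N"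
  shows False
proof -
  have "zmod.span {x, y} \<subseteq> N"
    using assms(3,4) zlattice_subspace[OF N(1)] by (intro zmod.span_minimal) auto
  then show False using N(2) span by blast
qed

text \<open>The norm is \<open>a * m\<^sup>2 + b * n\<^sup>2\<close>. On the \<open>x\<close>-axis a
  nonzero vector of \<open>N\<close> has \<open>\<bar>m\<bar> \<ge> 2\<close>, giving a multiple of
  \<open>a\<close> above \<open>a\<close>. Off it the norm exceeds \<open>b\<close>, since either
  \<open>m \<noteq> 0\<close> or \<open>\<bar>n\<bar> \<ge> 2\<close>.\<close>

lemma admissible_sublattice:
  assumes N: "zlattice N B" "N \<subset> L" and "x \<notin> N" "y \<notin> N"
  shows "admissible_lattice a b N B"
  unfolding admissible_lattice_def
proof (intro conjI ballI N(1))
  fix w assume w: "w \<in> N"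
  then have wL: "w \<in> L" using N(2) by blast
  have sub: "zscale c w \<in> N" for c
    using zmod.subspace_scale[OF zlattice_subspace[OF N(1)] w] .
  have norm: "B w w = a * (cx w)\<^sup>2 + b * (cy w)\<^sup>2"
    using form_coordinates[OF wL wL] by (simp add: power2_eq_square mult.assoc)
  have w_eq: "w = zscale (cx w) x + zscale (cy w) y" by (rule expand[OF wL])
  have notx: "\<bar>cx w\<bar> \<noteq> 1" if "cy w = 0"
  proof
    assume "\<bar>cx w\<bar> = 1"
    \<comment> \<open>Here \<open>w\<close> is \<open>x\<close> up to sign, and multiplying by that
      sign would put \<open>x\<close> into \<open>N\<close>.\<close>
    then have "cx w * cx w = 1" by (auto simp: abs_if split: if_splits)
    then have "zscale (cx w) w = x"
      by (subst w_eq) (simp add: that)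
    then show False using sub \<open>x \<notin> N\<close> by metis
  qed
  have noty: "\<bar>cy w\<bar> \<noteq> 1" if "cx w = 0"
  proof
    assume "\<bar>cy w\<bar> = 1"
    then have "cy w * cy w = 1" by (auto simp: abs_if split: if_splits)
    then have "zscale (cy w) w = y"
      by (subst w_eq) (simp add: that)
    then show False using sub \<open>y \<notin> N\<close> by metis
  qed
  show "admissible a b (B w w)"
  proof (cases "cy w = 0")
    case True
    show ?thesis
    proof (cases "cx w = 0")
      case False
      then have "2 \<le> \<bar>cx w\<bar>" using notx[OF True] by linarith
      then show ?thesis using multiple_square_gt[of a "cx w"] ab True norm
        by (simp add: admissible_def)
    qed (use True norm in \<open>simp add: admissible_def\<close>)
  next
    case False
    have "b < B w w"
    proof (cases "cx w = 0")
      case True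
      then have "2 \<le> \<bar>cy w\<bar>" using noty[OF True] False by linarith
      then show ?thesis using multiple_square_gt[of b "cy w"] ab True norm by simp
    next
      case cx: False
      have "0 < a * (cx w)\<^sup>2" using ab cx by simp
      moreover have "b * 1 \<le> b * (cy w)\<^sup>2"
        using int_square_ge_1[OF False] ab by (intro mult_left_mono) auto
      ultimately show ?thesis using norm by linarith
    qed
    then show ?thesis using ab by (simp add: admissible_def)
  qed
qed

text \<open>The nonzero norms are \<open>k * (c * s)\<^sup>2 > k\<close>: multiples of
  \<open>a\<close> above \<open>a\<close> if \<open>k = a\<close>, and above \<open>b\<close> if
  \<open>k = b\<close>.\<close>

lemma admissible_rank_one:
  assumes "k = a \<or> k = b" "2 \<le> c"
  shows "admissible_lattice a b (UNIV :: int set) (\<lambda>s t. k * c\<^sup>2 * s * t)"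
  unfolding admissible_lattice_def
proof (intro conjI ballI)
  show "zlattice (UNIV :: int set) (\<lambda>s t. k * c\<^sup>2 * s * t)"
    using assms ab by (intro zlattice_rank_one) auto
  fix s :: int
  have eq: "k * c\<^sup>2 * s * s = k * (c * s)\<^sup>2" by (simp add: power2_eq_square)
  show "admissible a b (k * c\<^sup>2 * s * s)"
  proof (cases "s = 0")
    case False
    then have "2 * 1 \<le> \<bar>c\<bar> * \<bar>s\<bar>" using assms(2) by (intro mult_mono) auto
    then have "k < k * (c * s)\<^sup>2"
      using assms ab by (intro multiple_square_gt) (auto simp: abs_mult)
    then show ?thesis unfolding eq admissible_def using assms(1) ab(2) dvd_triv_left by force
  qed (simp add: admissible_def)
qed

lemma sublattice_represented_with_x:
  assumes N: "zlattice N B" "N \<subset> L" and "x \<in> N"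
  shows "\<exists>c\<ge>2. represents (UNIV \<times> (UNIV :: int set))
    (orth_sum (glue_form a b) (\<lambda>s t. b * c\<^sup>2 * s * t)) N B"
proof -
  have sub: "zmod.subspace N" by (rule zlattice_subspace[OF N(1)])
  have "y \<notin> N" using proper_not_both[OF N \<open>x \<in> N\<close>] by blast
  then obtain c where c: "2 \<le> c" "\<And>n. zscale n y \<in> N \<Longrightarrow> c dvd n"
    using multiples_in_subspace[OF sub] by blast
  have NL: "w \<in> L" if "w \<in> N" for w using that N(2) by blast
  have dvd: "c dvd cy w" if "w \<in> N" for w
  proof (rule c(2))
    \<comment> \<open>As \<open>x\<close> lies in \<open>N\<close>, the \<open>y\<close>-component
      of each vector of \<open>N\<close> stays in \<open>N\<close>.\<close>
    have "zscale (cy w) y = w - zscale (cx w) x"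
      using expand[OF NL[OF that]] by (simp add: algebra_simps)
    then show "zscale (cy w) y \<in> N"
      using that zmod.subspace_scale[OF sub \<open>x \<in> N\<close>] by (simp add: zmod.subspace_diff[OF sub])
  qed
  \<comment> \<open>The \<open>x\<close>-component goes to the first axis of \<open>K\<close>.
    Dividing the other coordinate by \<open>c\<close> is exact on \<open>N\<close> and is
    compensated by the factor \<open>c\<^sup>2\<close> in the form.\<close>
  define s where "s w = ((cx w, 0 :: int), cy w div c)" for w
  have "s (v + w) = s v + s w" if "v \<in> N" "w \<in> N" for v w
    using that dvd by (simp add: s_def NL coordinates_add div_plus_div_distrib_dvd_left)
  moreover have "s (zscale k w) = zscale k (s w)" if "w \<in> N" for k w
    using that dvd by (simp add: s_def NL coordinates_scale zscale_Pair zscale_int div_mult_swap)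
  moreover have "orth_sum (glue_form a b) (\<lambda>s t. b * c\<^sup>2 * s * t) (s v) (s w) = B v w"
    if vw: "v \<in> N" "w \<in> N" for v w
  proof -
    have "cy v = c * (cy v div c)" "cy w = c * (cy w div c)" using vw dvd by simp_all
    then have "cy v * cy w = c * (cy v div c) * (c * (cy w div c))" by (rule arg_cong2)
    then have "b * cy v * cy w = b * c\<^sup>2 * (cy v div c) * (cy w div c)"
      by (simp add: power2_eq_square mult.assoc mult.left_commute)
    then show ?thesis
      unfolding form_coordinates[OF NL[OF vw(1)] NL[OF vw(2)]] s_def orth_sum_def glue_form_def
      by (simp only: fst_conv snd_conv)
  qed
  ultimately show ?thesis
    unfolding represents_def by (intro exI[of _ c] exI[of _ s] conjI c(1)) auto
qed

text \<open>The same construction with the axes exchanged. The norms of the rank one summand may now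
  lie below \<open>b\<close>, which is why \<open>admissible\<close> lets multiples of
  \<open>a\<close> through.\<close>

lemma sublattice_represented_with_y:
  assumes N: "zlattice N B" "N \<subset> L" and "y \<in> N"
  shows "\<exists>c\<ge>2. represents (UNIV \<times> (UNIV :: int set))
    (orth_sum (glue_form a b) (\<lambda>s t. a * c\<^sup>2 * s * t)) N B"
proof -
  have sub: "zmod.subspace N" by (rule zlattice_subspace[OF N(1)])
  have "x \<notin> N" using proper_not_both[OF N _ \<open>y \<in> N\<close>] by blast
  then obtain c where c: "2 \<le> c" "\<And>n. zscale n x \<in> N \<Longrightarrow> c dvd n"
    using multiples_in_subspace[OF sub] by blast
  have NL: "w \<in> L" if "w \<in> N" for w using that N(2) by blast
  have dvd: "c dvd cx w" if "w \<in> N" for w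
  proof (rule c(2))
    have "zscale (cx w) x = w - zscale (cy w) y"
      using expand[OF NL[OF that]] by (simp add: algebra_simps)
    then show "zscale (cx w) x \<in> N"
      using that zmod.subspace_scale[OF sub \<open>y \<in> N\<close>] by (simp add: zmod.subspace_diff[OF sub])
  qed
  define s where "s w = ((0 :: int, cy w), cx w div c)" for w
  have "s (v + w) = s v + s w" if "v \<in> N" "w \<in> N" for v w
    using that dvd by (simp add: s_def NL coordinates_add div_plus_div_distrib_dvd_left)
  moreover have "s (zscale k w) = zscale k (s w)" if "w \<in> N" for k w
    using that dvd by (simp add: s_def NL coordinates_scale zscale_Pair zscale_int div_mult_swap)
  moreover have "orth_sum (glue_form a b) (\<lambda>s t. a * c\<^sup>2 * s * t) (s v) (s w) = B v w"
    if vw: "v \<in> N" "w \<in> N" for v w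
  proof -
    have "cx v = c * (cx v div c)" "cx w = c * (cx w div c)" using vw dvd by simp_all
    then have "cx v * cx w = c * (cx v div c) * (c * (cx w div c))" by (rule arg_cong2)
    then have "a * cx v * cx w = a * c\<^sup>2 * (cx v div c) * (cx w div c)"
      by (simp add: power2_eq_square mult.assoc mult.left_commute)
    then show ?thesis
      unfolding form_coordinates[OF NL[OF vw(1)] NL[OF vw(2)]] s_def orth_sum_def glue_form_def
      by (simp only: fst_conv snd_conv)
  qed
  ultimately show ?thesis
    unfolding represents_def by (intro exI[of _ c] exI[of _ s] conjI c(1)) auto
qed

lemma sublattice_represented:
  assumes N: "zlattice N B" "N \<subset> L"
  shows "\<exists>(M :: (nat \<Rightarrow>\<^sub>0 int) set) C. admissible_lattice a b M C \<and>
    represents (UNIV \<times> M) (orth_sum (glue_form a b) C) N B"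
proof -
  consider "x \<in> N" | "y \<in> N" | "x \<notin> N" "y \<notin> N" by blast
  then show ?thesis
  proof cases
    case 1
    then show ?thesis
      using sublattice_represented_with_x[OF N] admissible_rank_one[of b] glued_copy by blast
  next
    case 2
    then show ?thesis
      using sublattice_represented_with_y[OF N] admissible_rank_one[of a] glued_copy by blast
  next
    case 3
    then show ?thesis
      using admissible_sublattice[OF N] represents_orth_sum_right[OF zlattice_glue_form[OF ab]]
        glued_copy by blast
  qed
qed

end

section \<open>One lattice representing a finite family of proper sublattices but not
  \<open>L\<close>\<close>

theorem proposition4p1:
  fixes a b :: int
    and L :: "'a::ab_group_add set"
    and B :: "'a \<Rightarrow> 'a \<Rightarrow> int"
  assumes "2 \<le> a" and "a < b" and "\<not> a dvd b"
    and "diagonal_zlattice [a, b] L B"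
  shows "\<not> recoverable L B"
proof
  assume rec: "recoverable L B"
  obtain xs where L: "zlattice L B" and xs: "length xs = length [a, b]" "zmod.span (set xs) = L"
    "\<forall>i<length [a, b]. \<forall>j<length [a, b]. B (xs ! i) (xs ! j) = (if i = j then [a, b] ! i else 0)"
    using assms(4) unfolding diagonal_zlattice_def by blast
  obtain x y where xy: "xs = [x, y]"
    using xs(1) by (auto simp: length_Suc_conv)
  have gram: "B x x = a" "B y y = b" "B x y = 0"
    using xs(3) unfolding xy by (auto simp: less_Suc_eq all_conj_distrib)
  interpret binary_diagonal a b L B x y
    using assms(1,2) L xs(2) gram by unfold_locales (auto simp: xy)
  \<comment> \<open>The test lattice \<open>K \<bottom> M\<close> lives on a product type, so
    recoverability is needed over that type.\<close>
  obtain S where S: "finite S" "\<forall>N\<in>S. proper_sublattice N L B"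
    "\<And>(M :: ((int \<times> int) \<times> (nat \<Rightarrow>\<^sub>0 int)) set) C.
       zlattice M C \<Longrightarrow> \<forall>N\<in>S. represents M C N B \<Longrightarrow> represents M C L B"
    using recoverable_any_type[OF rec, where 'b = "(int \<times> int) \<times> (nat \<Rightarrow>\<^sub>0 int)"] by blast
  have "\<forall>N\<in>S. \<exists>(M :: (nat \<Rightarrow>\<^sub>0 int) set) C. admissible_lattice a b M C \<and>
      represents (UNIV \<times> M) (orth_sum (glue_form a b) C) N B"
    using S(2) sublattice_represented unfolding proper_sublattice_def by blast
  then obtain F :: "'a set \<Rightarrow> (nat \<Rightarrow>\<^sub>0 int) set" and G where
    FG: "\<forall>N\<in>S. admissible_lattice a b (F N) (G N) \<and>
      represents (UNIV \<times> F N) (orth_sum (glue_form a b) (G N)) N B"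
    by metis
  \<comment> \<open>Finiteness of \<open>S\<close> allows a single complement to replace the
    separate ones.\<close>
  obtain M :: "(nat \<Rightarrow>\<^sub>0 int) set" and C where
    M: "admissible_lattice a b M C" "\<forall>N\<in>S. represents M C (F N) (G N)"
    using common_admissible_lattice[OF S(1), of a b F G] FG assms(1,2) by auto
  have "zlattice (UNIV \<times> M) (orth_sum (glue_form a b) C)"
    using M(1) zlattice_glue_form[OF ab] unfolding admissible_lattice_def
    by (intro zlattice_orth_sum) auto
  moreover have "\<forall>N\<in>S. represents (UNIV \<times> M) (orth_sum (glue_form a b) C) N B"
    using M(2) FG represents_orth_sum_mono represents_trans by blast
  ultimately have "represents (UNIV \<times> M) (orth_sum (glue_form a b) C) L B"
    by (rule S(3))
  then show False
    using not_represents_glued[OF ab assms(3) M(1) basis_in gram] by blast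
qed

end
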